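(* Fix $n\in\mathbb N$ and suppose that for all origin-symmetric convex sets $K,L\subseteq\mathbb R^n$ and all $\lambda\in(0,1)$ one has $\gamma_n(K^\lambda L^{1-\lambda})\ge\gamma_n(K)^\lambda\gamma_n(L)^{1-\lambda}$. Then for every origin-symmetric convex sets $K,L\subseteq\mathbb R^n$ and every $\lambda\in(0,1)$, $$\Psi_n^{-1}\big(\gamma_n\big(\lambda K+(1-\lambda)L\big)\big) \geq \sup_{p\in(0,1)} \Big(\frac{\lambda}{p}\Big)^p \Big(\frac{1-\lambda}{1-p}\Big)^{1-p}\, \Psi_n^{-1}\big(\gamma_n(K)^p\, \gamma_n(L)^{1-p}\big).$$
   Context: $\gamma_n$ is the standard Gaussian measure on $\mathbb R^n$ with density $(2\pi)^{-n/2}e^{-|x|^2/2}$. $\Psi_n:[0,\infty)\to[0,1)$ is $\Psi_n(r)=\gamma_n(\{x:|x|\le r\})$, extended by $\Psi_n(\infty)=1$, and $\Psi_n^{-1}$ is its inverse. For symmetric convex $K,L$ with support functions $h_K(\theta)=\sup_{y\in K}\langle y,\theta\rangle$, the $\lambda$-geometric mean is $K^\lambda L^{1-\lambda}=\bigcap_{\theta\in\mathbb S^{n-1}}\{x\in\mathbb R^n:\langle x,\theta\rangle\le h_K(\theta)^\lambda h_L(\theta)^{1-\lambda}\}$. A set is symmetric if $K=-K$; $\lambda K+(1-\lambda)L=\{\lambda a+(1-\lambda)b: a\in K, b\in L\}$. *)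

theory Defs
  imports "HOL-Analysis.Analysis"
begin

text \<open>Standard Gaussian density and measure on R^n, n = CARD('n).\<close>
definition gauss_dens :: "real^'n \<Rightarrow> real" where
  "gauss_dens x = (2 * pi) powr (- real CARD('n) / 2) * exp (- (norm x)\<^sup>2 / 2)"

definition gauss :: "(real^'n) set \<Rightarrow> real" where
  "gauss A = measure (density lebesgue (\<lambda>x. ennreal (gauss_dens x))) A"

text \<open>Psi_n(r) = gamma_n(closed ball of radius r), and its inverse (extended by Psi_n(infinity) = 1).\<close>
definition Psi :: "'n::finite itself \<Rightarrow> real \<Rightarrow> real" where
  "Psi _ r = gauss (cball (0::real^'n) r)"

definition Psi_inv :: "'n::finite itself \<Rightarrow> real \<Rightarrow> ereal" where
  "Psi_inv N t = (if t \<ge> 1 then \<infinity> else ereal (THE r. r \<ge> 0 \<and> Psi N r = t))"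

definition symmetric_set :: "(real^'n) set \<Rightarrow> bool" where
  "symmetric_set K \<longleftrightarrow> uminus ` K = K"

text \<open>Support function, with values in the extended reals.\<close>
definition supp_fun :: "(real^'n) set \<Rightarrow> real^'n \<Rightarrow> ereal" where
  "supp_fun K \<theta> = (SUP y\<in>K. ereal (y \<bullet> \<theta>))"

text \<open>Power on extended reals: infinity^t = infinity.\<close>
definition epow :: "ereal \<Rightarrow> real \<Rightarrow> ereal" where
  "epow x t = (if x = \<infinity> then \<infinity> else if x = -\<infinity> then -\<infinity> else ereal (real_of_ereal x powr t))"

definition geom_mean :: "(real^'n) set \<Rightarrow> (real^'n) set \<Rightarrow> real \<Rightarrow> (real^'n) set" where
  "geom_mean K L lam = (\<Inter>\<theta>\<in>sphere 0 1.
      {x. ereal (x \<bullet> \<theta>) \<le> epow (supp_fun K \<theta>) lam * epow (supp_fun L \<theta>) (1 - lam)})"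

definition minkowski_comb :: "real \<Rightarrow> (real^'n) set \<Rightarrow> (real^'n) set \<Rightarrow> (real^'n) set" where
  "minkowski_comb lam K L = {lam *\<^sub>R a + (1 - lam) *\<^sub>R b | a b. a \<in> K \<and> b \<in> L}"

end

theory Submission
  imports Defs "HOL-Probability.Probability"
begin

text \<open>
  Let \<open>c = (\<lambda>/p)^p ((1-\<lambda>)/(1-p))^(1-p)\<close>, so \<open>0 < c \<le> 1\<close>. For a unit vector \<open>\<theta>\<close> and \<open>x\<close>
  in \<open>K^p L^(1-p)\<close>, weighted AM-GM gives
  \<open>c \<langle>x,\<theta>\<rangle> \<le> c h\<^sub>K(\<theta>)^p h\<^sub>L(\<theta>)^(1-p) \<le> \<lambda> h\<^sub>K(\<theta>) + (1-\<lambda>) h\<^sub>L(\<theta>)\<close>, the support function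
  of \<open>\<lambda>K + (1-\<lambda>)L\<close>. By separation, \<open>c K^p L^(1-p)\<close> lies in the closure of this convex set,
  which has the same Gaussian measure. With the hypothesis \<open>\<gamma>(K^p L^(1-p)) \<ge> \<gamma>(K)^p \<gamma>(L)^(1-p)\<close>
  it remains to see \<open>\<Psi>\<inverse>(\<gamma>(cA)) \<ge> c \<Psi>\<inverse>(\<gamma>(A))\<close>. Now \<open>\<gamma>(cA)\<close> is the integral over \<open>A\<close>,
  with respect to \<open>\<gamma>\<close>, of \<open>c^n exp((1-c\<^sup>2)|x|\<^sup>2/2)\<close>, which increases with \<open>|x|\<close>; so among sets
  of a given Gaussian measure the centred ball minimises this integral (bathtub principle),
  i.e. \<open>\<gamma>(A) \<ge> \<Psi>(r)\<close> implies \<open>\<gamma>(cA) \<ge> \<Psi>(cr)\<close>.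
\<close>

section \<open>The Gaussian measure\<close>

abbreviation gauss_measure :: "(real^'n) measure" where
  "gauss_measure \<equiv> density lebesgue (\<lambda>x. ennreal (gauss_dens x))"

lemma gauss_dens_pos: "0 < gauss_dens x"
  by (simp add: gauss_dens_def)

lemma gauss_dens_le_gauss_dens_0:
  fixes x :: "real^'n"
  shows "gauss_dens x \<le> gauss_dens (0::real^'n)"
  unfolding gauss_dens_def by (intro mult_left_mono) auto

lemma gauss_dens_lower_bound:
  fixes x :: "real^'n"
  assumes "norm x \<le> R"
  shows "gauss_dens (0::real^'n) * exp (- R\<^sup>2 / 2) \<le> gauss_dens x"
proof -
  have "(norm x)\<^sup>2 \<le> R\<^sup>2"
    using assms by (intro power_mono) auto
  then show ?thesis
    unfolding gauss_dens_def by (simp add: mult.assoc mult_left_mono)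
qed

lemma continuous_imp_borel_measurable_lebesgue:
  "continuous_on UNIV f \<Longrightarrow> f \<in> borel_measurable lebesgue"
  using continuous_imp_measurable_on_sets_lebesgue [of UNIV f] by (simp add: lebesgue_on_UNIV_eq)

lemma borel_measurable_gauss_dens [measurable]:
  "(gauss_dens :: real^'n \<Rightarrow> real) \<in> borel_measurable lebesgue"
  unfolding gauss_dens_def [abs_def]
  by (intro continuous_imp_borel_measurable_lebesgue continuous_intros) auto

lemma gauss_dens_eq_prod_std_normal_density:
  "gauss_dens (x::real^'n) = (\<Prod>b\<in>Basis. std_normal_density (x \<bullet> b))"
proof -
  have "(\<Prod>b\<in>Basis. std_normal_density (x \<bullet> b)) =
      (\<Prod>b\<in>(Basis::(real^'n) set). 1 / sqrt (2 * pi)) * (\<Prod>b\<in>Basis. exp (- (x \<bullet> b)\<^sup>2 / 2))"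
    unfolding std_normal_density_def prod.distrib [symmetric] by simp
  also have "(\<Prod>b\<in>Basis. exp (- (x \<bullet> b)\<^sup>2 / 2)) = exp (\<Sum>b\<in>Basis. - (x \<bullet> b)\<^sup>2 / 2)"
    by (simp add: exp_sum)
  also have "(\<Sum>b\<in>Basis. - (x \<bullet> b)\<^sup>2 / 2) = - (norm x)\<^sup>2 / 2"
  proof -
    have "(norm x)\<^sup>2 = (\<Sum>b\<in>Basis. (x \<bullet> b)\<^sup>2)"
      unfolding power2_norm_eq_inner by (subst euclidean_inner) (simp add: power2_eq_square)
    then show ?thesis
      by (simp add: sum_divide_distrib sum_negf)
  qed
  also have "(\<Prod>b\<in>(Basis::(real^'n) set). 1 / sqrt (2 * pi)) = (2 * pi) powr (- real CARD('n) / 2)"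
  proof -
    have "(\<Prod>b\<in>(Basis::(real^'n) set). 1 / sqrt (2 * pi)) = ((2 * pi) powr (-1/2)) ^ CARD('n)"
      by (simp add: powr_minus_divide sqrt_def root_powr_inverse powr_half_sqrt [symmetric])
    also have "\<dots> = (2 * pi) powr (- real CARD('n) / 2)"
      by (simp add: powr_realpow [symmetric] powr_powr flip: powr_power)
    finally show ?thesis .
  qed
  finally show ?thesis
    by (simp add: gauss_dens_def)
qed

lemma prob_space_gauss_measure: "prob_space (gauss_measure :: (real^'n) measure)"
proof (rule prob_spaceI)
  have "emeasure (gauss_measure :: (real^'n) measure) UNIV
      = (\<integral>\<^sup>+x. ennreal (gauss_dens (x::real^'n)) \<partial>lebesgue)"
    by (subst emeasure_density) auto
  also have "\<dots> = (\<integral>\<^sup>+x. ennreal (gauss_dens (x::real^'n)) \<partial>lborel)"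
    by (simp add: nn_integral_completion)
  also have "\<dots> = (\<integral>\<^sup>+x. (\<Prod>b\<in>Basis. ennreal (std_normal_density ((x::real^'n) \<bullet> b))) \<partial>lborel)"
    by (simp add: gauss_dens_eq_prod_std_normal_density prod_ennreal)
  also have "\<dots> = (\<Prod>b\<in>(Basis::(real^'n) set). \<integral>\<^sup>+x. ennreal (std_normal_density x) \<partial>lborel)"
    by (rule nn_integral_lborel_prod) auto
  also have "(\<integral>\<^sup>+x. ennreal (std_normal_density x) \<partial>lborel) = 1"
    by (subst nn_integral_eq_integral) auto
  finally show "emeasure (gauss_measure :: (real^'n) measure) (space gauss_measure) = 1"
    by simp
qed

lemma emeasure_gauss_measure: "emeasure (gauss_measure :: (real^'n) measure) A = ennreal (gauss A)"
proof -
  interpret prob_space "gauss_measure :: (real^'n) measure"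
    by (rule prob_space_gauss_measure)
  show ?thesis
    using emeasure_eq_measure [of A] by (simp add: gauss_def)
qed

lemma gauss_nonneg: "0 \<le> gauss A"
  by (simp add: gauss_def)

lemma gauss_le_1: "gauss (A :: (real^'n) set) \<le> 1"
  using prob_space.prob_le_1 [OF prob_space_gauss_measure] by (simp add: gauss_def)

lemma gauss_mono: "A \<subseteq> B \<Longrightarrow> B \<in> sets lebesgue \<Longrightarrow> gauss (A :: (real^'n) set) \<le> gauss B"
proof -
  interpret prob_space "gauss_measure :: (real^'n) measure"
    by (rule prob_space_gauss_measure)
  show "A \<subseteq> B \<Longrightarrow> B \<in> sets lebesgue \<Longrightarrow> gauss A \<le> gauss B"
    using finite_measure_mono [of A B] by (simp add: gauss_def)
qed

lemma gauss_Diff: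
  "A \<in> sets lebesgue \<Longrightarrow> B \<in> sets lebesgue \<Longrightarrow> B \<subseteq> A \<Longrightarrow>
    gauss ((A :: (real^'n) set) - B) = gauss A - gauss B"
proof -
  interpret prob_space "gauss_measure :: (real^'n) measure"
    by (rule prob_space_gauss_measure)
  show "A \<in> sets lebesgue \<Longrightarrow> B \<in> sets lebesgue \<Longrightarrow> B \<subseteq> A \<Longrightarrow> gauss (A - B) = gauss A - gauss B"
    using finite_measure_Diff [of A B] by (simp add: gauss_def)
qed

lemma null_sets_lebesgue_imp_gauss_measure:
  assumes "N \<in> null_sets lebesgue"
  shows "N \<in> null_sets (gauss_measure :: (real^'n) measure)"
proof -
  have "AE x in lebesgue. x \<in> N \<longrightarrow> ennreal (gauss_dens (x::real^'n)) = 0"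
    using AE_not_in [OF assms] by eventually_elim auto
  then show ?thesis
    using assms by (subst null_sets_density_iff) auto
qed

lemma gauss_null: "N \<in> null_sets lebesgue \<Longrightarrow> gauss (N :: (real^'n) set) = 0"
  using null_sets_lebesgue_imp_gauss_measure [of N] by (simp add: gauss_def measure_def null_setsD1)

lemma emeasure_gauss_measure_le_lebesgue:
  fixes S :: "(real^'n) set"
  assumes "S \<in> sets lebesgue"
  shows "emeasure gauss_measure S \<le> ennreal (gauss_dens (0::real^'n)) * emeasure lebesgue S"
proof -
  have "emeasure gauss_measure S = (\<integral>\<^sup>+x. ennreal (gauss_dens x) * indicator S x \<partial>lebesgue)"
    using assms by (subst emeasure_density) auto
  also have "\<dots> \<le> (\<integral>\<^sup>+x. ennreal (gauss_dens (0::real^'n)) * indicator S x \<partial>lebesgue)"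
    by (intro nn_integral_mono mult_right_mono ennreal_leI gauss_dens_le_gauss_dens_0) auto
  also have "\<dots> = ennreal (gauss_dens (0::real^'n)) * emeasure lebesgue S"
    using assms by (rule nn_integral_cmult_indicator)
  finally show ?thesis .
qed

lemma emeasure_gauss_measure_ge_lebesgue:
  fixes S :: "(real^'n) set"
  assumes "S \<in> sets lebesgue" "S \<subseteq> cball 0 R"
  shows "ennreal (gauss_dens (0::real^'n) * exp (- R\<^sup>2 / 2)) * emeasure lebesgue S
    \<le> emeasure gauss_measure S"
proof -
  have "ennreal (gauss_dens (0::real^'n) * exp (- R\<^sup>2 / 2)) * emeasure lebesgue S
      = (\<integral>\<^sup>+x. ennreal (gauss_dens (0::real^'n) * exp (- R\<^sup>2 / 2)) * indicator S x \<partial>lebesgue)"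
    using assms(1) by (rule nn_integral_cmult_indicator [symmetric])
  also have "\<dots> \<le> (\<integral>\<^sup>+x. ennreal (gauss_dens x) * indicator S x \<partial>lebesgue)"
  proof (rule nn_integral_mono)
    fix x :: "real^'n"
    show "ennreal (gauss_dens (0::real^'n) * exp (- R\<^sup>2 / 2)) * indicator S x \<le> ennreal (gauss_dens x) * indicator S x"
      using assms(2) gauss_dens_lower_bound [of x R]
      by (cases "x \<in> S") (auto simp: subset_iff intro!: ennreal_leI)
  qed
  also have "\<dots> = emeasure gauss_measure S"
    using assms(1) by (subst emeasure_density) auto
  finally show ?thesis .
qed

section \<open>Dilations\<close>

lemma nn_integral_scaleR_lebesgue:
  fixes f :: "'a::euclidean_space \<Rightarrow> ennreal"
  assumes f [measurable]: "f \<in> borel_measurable lebesgue" and c: "c \<noteq> 0"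
  shows "(\<integral>\<^sup>+x. f x \<partial>lebesgue) = ennreal (\<bar>c\<bar> ^ DIM('a)) * (\<integral>\<^sup>+x. f (c *\<^sub>R x) \<partial>lebesgue)"
proof -
  have T: "(\<lambda>x::'a. 0 + (\<Sum>j\<in>Basis. (c * (x \<bullet> j)) *\<^sub>R j)) = (\<lambda>x. c *\<^sub>R x)"
    unfolding scaleR_scaleR [symmetric] scaleR_sum_right [symmetric] euclidean_representation by simp
  let ?D = "distr lebesgue lebesgue (\<lambda>x::'a. c *\<^sub>R x)"
  have fD: "f \<in> borel_measurable ?D"
    using f by (simp cong: measurable_cong_sets)
  have "(\<integral>\<^sup>+x. f x \<partial>lebesgue) = (\<integral>\<^sup>+x. f x \<partial>density ?D (\<lambda>_. ennreal (\<bar>c\<bar> ^ DIM('a))))"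
    using lebesgue_affine_euclidean [where c = "\<lambda>_::'a. c" and t = 0] c
    unfolding T prod_constant by simp
  also have "\<dots> = ennreal (\<bar>c\<bar> ^ DIM('a)) * integral\<^sup>N ?D f"
    using fD by (simp add: nn_integral_density nn_integral_cmult)
  also have "integral\<^sup>N ?D f = (\<integral>\<^sup>+x. f (c *\<^sub>R x) \<partial>lebesgue)"
    by (rule nn_integral_distr) simp_all
  finally show ?thesis .
qed

definition dilation_weight :: "real \<Rightarrow> real^'n \<Rightarrow> real" where
  "dilation_weight c x = c ^ CARD('n) * exp ((1 - c\<^sup>2) * (norm x)\<^sup>2 / 2)"

lemma dilation_weight_nonneg: "0 < c \<Longrightarrow> 0 \<le> dilation_weight c x"
  by (simp add: dilation_weight_def)

lemma borel_measurable_dilation_weight [measurable]: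
  "dilation_weight c \<in> borel_measurable lebesgue"
  unfolding dilation_weight_def [abs_def]
  by (intro continuous_imp_borel_measurable_lebesgue continuous_intros) auto

lemma dilation_weight_mono:
  fixes x y :: "real^'n"
  assumes "0 < c" "c \<le> 1" "norm x \<le> norm y"
  shows "dilation_weight c x \<le> dilation_weight c y"
proof -
  have "(1 - c\<^sup>2) * (norm x)\<^sup>2 \<le> (1 - c\<^sup>2) * (norm y)\<^sup>2"
    using assms by (intro mult_left_mono power_mono) (auto simp: power_le_one)
  then show ?thesis
    unfolding dilation_weight_def using assms(1) by (intro mult_left_mono) auto
qed

lemma gauss_dens_scaleR:
  "c ^ CARD('n) * gauss_dens (c *\<^sub>R x) = gauss_dens x * dilation_weight c (x::real^'n)"
proof -
  have "exp (- (norm (c *\<^sub>R x))\<^sup>2 / 2) = exp (- (norm x)\<^sup>2 / 2) * exp ((1 - c\<^sup>2) * (norm x)\<^sup>2 / 2)"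
    by (simp add: power_mult_distrib algebra_simps flip: exp_add)
  then show ?thesis
    unfolding gauss_dens_def dilation_weight_def by (simp add: mult_ac)
qed

lemma sets_lebesgue_scaleR:
  fixes A :: "'a::euclidean_space set"
  assumes "A \<in> sets lebesgue" "c \<noteq> 0"
  shows "(*\<^sub>R) c ` A \<in> sets lebesgue"
proof -
  have "(*\<^sub>R) c ` A = (*\<^sub>R) (1 / c) -` A \<inter> space lebesgue"
  proof (intro equalityI subsetI)
    fix y assume "y \<in> (*\<^sub>R) c ` A"
    then show "y \<in> (*\<^sub>R) (1 / c) -` A \<inter> space lebesgue"
      using assms(2) by auto
  next
    fix y assume "y \<in> (*\<^sub>R) (1 / c) -` A \<inter> space lebesgue"
    moreover have "y = c *\<^sub>R ((1 / c) *\<^sub>R y)"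
      using assms(2) by simp
    ultimately show "y \<in> (*\<^sub>R) c ` A"
      by blast
  qed
  then show ?thesis
    using measurable_sets [OF lebesgue_measurable_scaling assms(1)] by simp
qed

lemma emeasure_gauss_measure_scaleR:
  fixes A :: "(real^'n) set"
  assumes A [measurable]: "A \<in> sets lebesgue" and c: "0 < c"
  shows "emeasure gauss_measure ((*\<^sub>R) c ` A) = (\<integral>\<^sup>+x\<in>A. ennreal (dilation_weight c x) \<partial>gauss_measure)"
proof -
  have cA [measurable]: "(*\<^sub>R) c ` A \<in> sets lebesgue"
    using c by (intro sets_lebesgue_scaleR A) auto
  have ind: "indicator ((*\<^sub>R) c ` A) (c *\<^sub>R x) = (indicator A x :: ennreal)" for x :: "real^'n"
    using c by (auto simp: indicator_def image_iff)
  have "emeasure gauss_measure ((*\<^sub>R) c ` A) =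
      (\<integral>\<^sup>+x. ennreal (gauss_dens x) * indicator ((*\<^sub>R) c ` A) x \<partial>lebesgue)"
    by (subst emeasure_density) auto
  also have "\<dots> = ennreal (c ^ CARD('n)) * (\<integral>\<^sup>+x. ennreal (gauss_dens (c *\<^sub>R x)) * indicator A x \<partial>lebesgue)"
    using c by (subst nn_integral_scaleR_lebesgue [of _ c]) (auto simp: ind)
  also have "\<dots> = (\<integral>\<^sup>+x. ennreal (gauss_dens x) * (ennreal (dilation_weight c x) * indicator A x) \<partial>lebesgue)"
  proof (subst nn_integral_cmult [symmetric], simp, rule nn_integral_cong)
    fix x :: "real^'n"
    have "ennreal (c ^ CARD('n)) * ennreal (gauss_dens (c *\<^sub>R x)) =
        ennreal (c ^ CARD('n) * gauss_dens (c *\<^sub>R x))"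
      using c gauss_dens_pos [of "c *\<^sub>R x"] by (simp add: ennreal_mult)
    also have "\<dots> = ennreal (gauss_dens x) * ennreal (dilation_weight c x)"
      using gauss_dens_pos [of x] dilation_weight_nonneg [OF c, of x]
      by (simp add: gauss_dens_scaleR ennreal_mult)
    finally have "ennreal (c ^ CARD('n)) * ennreal (gauss_dens (c *\<^sub>R x)) =
        ennreal (gauss_dens x) * ennreal (dilation_weight c x)" .
    then show "ennreal (c ^ CARD('n)) * (ennreal (gauss_dens (c *\<^sub>R x)) * indicator A x) =
        ennreal (gauss_dens x) * (ennreal (dilation_weight c x) * indicator A x)"
      by (simp add: mult.assoc [symmetric])
  qed
  also have "\<dots> = (\<integral>\<^sup>+x\<in>A. ennreal (dilation_weight c x) \<partial>gauss_measure)"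
    by (subst nn_integral_density) auto
  finally show ?thesis .
qed

lemma nn_integral_bathtub_le:
  fixes w :: "'a \<Rightarrow> ennreal"
  assumes [measurable]: "A \<in> sets M" "B \<in> sets M" "w \<in> borel_measurable M"
    and finite: "emeasure M A \<noteq> \<infinity>" and le: "emeasure M B \<le> emeasure M A"
    and below: "\<And>x. x \<in> B \<Longrightarrow> w x \<le> t"
    and above: "\<And>x. x \<in> space M \<Longrightarrow> x \<notin> B \<Longrightarrow> t \<le> w x"
  shows "(\<integral>\<^sup>+x\<in>B. w x \<partial>M) \<le> (\<integral>\<^sup>+x\<in>A. w x \<partial>M)"
proof -
  have measure_split: "emeasure M S = emeasure M (S \<inter> T) + emeasure M (S - T)"
    if "S \<in> sets M" "T \<in> sets M" for S T
    using plus_emeasure [of "S \<inter> T" M "S - T"] that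
    by (simp add: Int_Diff_Un Int_Diff_disjoint sets.Int sets.Diff)
  have integral_split: "(\<integral>\<^sup>+x\<in>S. w x \<partial>M) = (\<integral>\<^sup>+x\<in>S \<inter> T. w x \<partial>M) + (\<integral>\<^sup>+x\<in>S - T. w x \<partial>M)"
    if "S \<in> sets M" "T \<in> sets M" for S T
    using nn_integral_disjoint_pair [of w M "S \<inter> T" "S - T"] that
    by (simp add: Int_Diff_Un Int_Diff_disjoint sets.Int sets.Diff)
  have "emeasure M (A \<inter> B) \<noteq> \<infinity>"
    using finite emeasure_mono [of "A \<inter> B" A M] by (auto simp: top_unique)
  moreover have "emeasure M (A \<inter> B) + emeasure M (B - A) \<le> emeasure M (A \<inter> B) + emeasure M (A - B)"
    using le measure_split [of A B] measure_split [of B A] by (simp add: Int_commute)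
  ultimately have BA: "emeasure M (B - A) \<le> emeasure M (A - B)"
    by (simp add: ennreal_add_left_cancel_le)
  have "(\<integral>\<^sup>+x\<in>B - A. w x \<partial>M) \<le> (\<integral>\<^sup>+x\<in>B - A. t \<partial>M)"
    using below by (intro nn_integral_mono) (auto simp: indicator_def)
  also have "\<dots> = t * emeasure M (B - A)"
    by (simp add: nn_integral_cmult_indicator)
  also have "\<dots> \<le> t * emeasure M (A - B)"
    using BA by (rule mult_left_mono) simp
  also have "\<dots> = (\<integral>\<^sup>+x\<in>A - B. t \<partial>M)"
    by (simp add: nn_integral_cmult_indicator)
  also have "\<dots> \<le> (\<integral>\<^sup>+x\<in>A - B. w x \<partial>M)"
    using above by (intro nn_integral_mono) (auto simp: indicator_def)
  finally have "(\<integral>\<^sup>+x\<in>B - A. w x \<partial>M) \<le> (\<integral>\<^sup>+x\<in>A - B. w x \<partial>M)" .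
  then show ?thesis
    using integral_split [of B A] integral_split [of A B]
    by (simp add: Int_commute add_left_mono)
qed

lemma gauss_cball_scaleR_le:
  fixes A :: "(real^'n) set"
  assumes A [measurable]: "A \<in> sets lebesgue" and c: "0 < c" "c \<le> 1" and r: "0 \<le> r"
    and le: "gauss (cball (0::real^'n) r) \<le> gauss A"
  shows "gauss (cball (0::real^'n) (c * r)) \<le> gauss ((*\<^sub>R) c ` A)"
proof -
  obtain e :: "real^'n" where e: "norm e = 1"
    using vector_choose_size [of 1] by auto
  let ?B = "cball (0::real^'n) r"
  have "(\<integral>\<^sup>+x\<in>?B. ennreal (dilation_weight c x) \<partial>gauss_measure)
      \<le> (\<integral>\<^sup>+x\<in>A. ennreal (dilation_weight c x) \<partial>gauss_measure)"
  proof (rule nn_integral_bathtub_le [where t = "ennreal (dilation_weight c (r *\<^sub>R e))"])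
    show "emeasure gauss_measure ?B \<le> emeasure gauss_measure A"
      unfolding emeasure_gauss_measure using le by (rule ennreal_leI)
    show "ennreal (dilation_weight c x) \<le> ennreal (dilation_weight c (r *\<^sub>R e))" if "x \<in> ?B" for x
      using that c r e by (intro ennreal_leI dilation_weight_mono) auto
    show "ennreal (dilation_weight c (r *\<^sub>R e)) \<le> ennreal (dilation_weight c x)" if "x \<notin> ?B" for x
      using that c r e by (intro ennreal_leI dilation_weight_mono) auto
  qed (auto simp: emeasure_gauss_measure)
  then have "emeasure gauss_measure ((*\<^sub>R) c ` ?B) \<le> emeasure gauss_measure ((*\<^sub>R) c ` A)"
    using c by (simp add: emeasure_gauss_measure_scaleR)
  moreover have "(*\<^sub>R) c ` ?B = cball 0 (c * r)"
    using cball_scale [of c 0 r] c by simp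
  ultimately show ?thesis
    by (simp add: emeasure_gauss_measure gauss_nonneg)
qed

section \<open>The radial distribution function \<open>\<Psi>\<close> and its inverse\<close>

lemma gauss_ball_pos:
  fixes p :: "real^'n"
  assumes "0 < \<delta>"
  shows "0 < gauss (ball p \<delta>)"
proof -
  let ?k = "gauss_dens (0::real^'n) * exp (- (norm p + \<delta>)\<^sup>2 / 2)"
  have sub: "ball p \<delta> \<subseteq> cball 0 (norm p + \<delta>)"
  proof
    fix x assume "x \<in> ball p \<delta>"
    then show "x \<in> cball 0 (norm p + \<delta>)"
      using norm_triangle_sub [of x p] by (simp add: dist_norm norm_minus_commute)
  qed
  have "emeasure lebesgue (ball p \<delta>) = ennreal (unit_ball_vol (real CARD('n)) * \<delta> ^ CARD('n))"
    using emeasure_ball [where c = p and r = \<delta>] assms by simp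
  then have "0 < ennreal ?k * emeasure lebesgue (ball p \<delta>)"
    using assms gauss_dens_pos [of "0::real^'n"] by (simp flip: ennreal_mult)
  also have "\<dots> \<le> emeasure gauss_measure (ball p \<delta>)"
    using sub by (intro emeasure_gauss_measure_ge_lebesgue) auto
  finally show ?thesis
    by (simp add: emeasure_gauss_measure)
qed

lemma Psi_mono: "r \<le> r' \<Longrightarrow> Psi N r \<le> Psi N r'"
  unfolding Psi_def by (rule gauss_mono) auto

lemma Psi_le_1: "Psi N r \<le> 1"
  unfolding Psi_def by (rule gauss_le_1)

lemma Psi_0: "Psi (N::'n::finite itself) 0 = 0"
  unfolding Psi_def using negligible_sing [of "0::real^'n"]
  by (intro gauss_null) (simp add: negligible_iff_null_sets)

lemma Psi_strict_mono:
  assumes "0 \<le> r" "r < r'"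
  shows "Psi (N::'n::finite itself) r < Psi N r'"
proof -
  obtain e :: "real^'n" where e: "norm e = 1"
    using vector_choose_size [of 1] by auto
  define p where "p = ((r + r') / 2) *\<^sub>R e"
  have "norm p = (r + r') / 2"
    using assms e by (simp add: p_def)
  have sub: "ball p ((r' - r) / 2) \<subseteq> cball 0 r' - cball 0 r"
  proof
    fix x assume "x \<in> ball p ((r' - r) / 2)"
    then have "norm (x - p) < (r' - r) / 2"
      by (simp add: dist_norm norm_minus_commute)
    moreover have "norm x \<le> norm p + norm (x - p)" "norm p \<le> norm x + norm (x - p)"
      using norm_triangle_sub [of x p] norm_triangle_sub [of p x] by (simp_all add: norm_minus_commute)
    ultimately show "x \<in> cball 0 r' - cball 0 r"
      using \<open>norm p = (r + r') / 2\<close> by (simp; linarith)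
  qed
  have "0 < gauss (ball p ((r' - r) / 2))"
    using assms by (intro gauss_ball_pos) simp
  also have "\<dots> \<le> gauss (cball (0::real^'n) r' - cball 0 r)"
    using sub by (rule gauss_mono) auto
  also have "\<dots> = Psi N r' - Psi N r"
    using assms by (subst gauss_Diff) (auto simp: Psi_def subset_cball)
  finally show ?thesis
    by simp
qed

lemma Psi_le_Psi_iff: "0 \<le> r' \<Longrightarrow> Psi (N::'n::finite itself) r \<le> Psi N r' \<longleftrightarrow> r \<le> r'"
  using Psi_strict_mono [of r' r N] Psi_mono [of r r' N] by force

lemma Psi_less_1: "Psi (N::'n::finite itself) r < 1"
proof -
  have "Psi N r \<le> Psi N (max r 0)"
    by (rule Psi_mono) simp
  also have "\<dots> < Psi N (max r 0 + 1)"
    by (rule Psi_strict_mono) auto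
  also have "\<dots> \<le> 1"
    by (rule Psi_le_1)
  finally show ?thesis .
qed

lemma Psi_diff_le:
  assumes "0 \<le> r" "r \<le> r'"
  shows "Psi (N::'n::finite itself) r' - Psi N r
    \<le> gauss_dens (0::real^'n) * unit_ball_vol (real CARD('n)) * (r' ^ CARD('n) - r ^ CARD('n))"
proof -
  let ?D = "cball (0::real^'n) r' - cball 0 r"
  have mono: "r ^ CARD('n) \<le> r' ^ CARD('n)"
    using assms by (intro power_mono) auto
  have "ennreal (Psi N r' - Psi N r) = emeasure gauss_measure ?D"
    unfolding Psi_def using assms by (simp add: gauss_Diff emeasure_gauss_measure subset_cball)
  also have "\<dots> \<le> ennreal (gauss_dens (0::real^'n)) * emeasure lebesgue ?D"
    by (rule emeasure_gauss_measure_le_lebesgue) simp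
  also have "emeasure lebesgue ?D = ennreal (unit_ball_vol (real CARD('n)) * (r' ^ CARD('n) - r ^ CARD('n)))"
    using assms by (subst emeasure_Diff) (auto simp: emeasure_cball ennreal_minus subset_cball algebra_simps)
  finally show ?thesis
    using mono gauss_dens_pos [of "0::real^'n"] by (simp flip: ennreal_mult)
qed

lemma continuous_on_if_increments_le:
  fixes f g :: "real \<Rightarrow> real"
  assumes g: "continuous_on S g"
    and le: "\<And>x y. x \<in> S \<Longrightarrow> y \<in> S \<Longrightarrow> \<bar>f y - f x\<bar> \<le> \<bar>g y - g x\<bar>"
  shows "continuous_on S f"
  unfolding continuous_on_def
proof
  fix x assume x: "x \<in> S"
  have "((\<lambda>y. g y - g x) \<longlongrightarrow> 0) (at x within S)"
    using g x by (simp add: continuous_on_def LIM_zero_iff)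
  then have "((\<lambda>y. \<bar>g y - g x\<bar>) \<longlongrightarrow> 0) (at x within S)"
    using tendsto_rabs by force
  moreover have "eventually (\<lambda>y. norm (f y - f x) \<le> \<bar>g y - g x\<bar>) (at x within S)"
    using le x by (auto simp: eventually_at_filter)
  ultimately have "((\<lambda>y. f y - f x) \<longlongrightarrow> 0) (at x within S)"
    by (rule Lim_null_comparison [rotated])
  then show "(f \<longlongrightarrow> f x) (at x within S)"
    by (simp add: LIM_zero_iff)
qed

lemma Psi_continuous_on: "continuous_on {0..} (Psi (N::'n::finite itself))"
proof (rule continuous_on_if_increments_le)
  let ?g = "\<lambda>r. gauss_dens (0::real^'n) * unit_ball_vol (real CARD('n)) * r ^ CARD('n)"
  show "continuous_on {0..} ?g"
    by (intro continuous_intros)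
  have bound: "\<bar>Psi N y - Psi N x\<bar> \<le> \<bar>?g y - ?g x\<bar>" if "0 \<le> x" "x \<le> y" for x y
  proof -
    have "0 \<le> ?g y - ?g x"
      using that gauss_dens_pos [of "0::real^'n"]
      by (simp add: mult_left_mono power_mono flip: right_diff_distrib)
    then show ?thesis
      using that Psi_diff_le [OF that, of N] Psi_mono [OF that(2), of N]
      by (simp add: right_diff_distrib)
  qed
  fix x y :: real
  assume "x \<in> {0..}" "y \<in> {0..}"
  then show "\<bar>Psi N y - Psi N x\<bar> \<le> \<bar>?g y - ?g x\<bar>"
    using bound [of x y] bound [of y x] by (cases "x \<le> y") (auto simp: abs_minus_commute)
qed

lemma ex_Psi_gt:
  assumes "a < 1"
  shows "\<exists>r\<ge>0. a < Psi (N::'n::finite itself) r"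
proof (rule ccontr)
  assume "\<not> ?thesis"
  then have le: "Psi N (real n) \<le> a" for n
    by (meson not_le of_nat_0_le_iff)
  have "(\<Union>n. cball (0::real^'n) (real n)) = UNIV"
    by (auto intro: real_arch_simple)
  then have "1 = (SUP n. emeasure (gauss_measure :: (real^'n) measure) (cball 0 (real n)))"
    using prob_space.emeasure_space_1 [OF prob_space_gauss_measure]
    by (subst SUP_emeasure_incseq) (auto simp: incseq_def)
  also have "\<dots> \<le> ennreal a"
    using le by (intro SUP_least) (simp add: emeasure_gauss_measure Psi_def ennreal_leI)
  finally show False
    using assms by (cases "0 \<le> a") (auto simp: ennreal_le_1 ennreal_neg)
qed

lemma Psi_surj:
  assumes "0 \<le> a" "a < 1"
  obtains R where "0 \<le> R" "Psi (N::'n::finite itself) R = a"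
proof -
  obtain r where r: "0 \<le> r" "a < Psi N r"
    using ex_Psi_gt [OF assms(2)] by blast
  have "continuous_on {0..r} (Psi N)"
    using Psi_continuous_on by (rule continuous_on_subset) auto
  then have "\<exists>R. 0 \<le> R \<and> R \<le> r \<and> Psi N R = a"
    using assms r Psi_0 [of N] by (intro IVT') auto
  then show ?thesis
    using that by blast
qed

lemma Psi_inv_Psi:
  assumes "0 \<le> R"
  shows "Psi_inv (N::'n::finite itself) (Psi N R) = ereal R"
proof -
  have "(THE r. 0 \<le> r \<and> Psi N r = Psi N R) = R"
  proof (rule the_equality)
    fix r assume "0 \<le> r \<and> Psi N r = Psi N R"
    then show "r = R"
      using assms Psi_le_Psi_iff [of R N r] Psi_le_Psi_iff [of r N R] by auto
  qed (use assms in simp)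
  then show ?thesis
    using Psi_less_1 [of N R] by (simp add: Psi_inv_def)
qed

lemma Psi_inv_0: "Psi_inv (N::'n::finite itself) 0 = 0"
  using Psi_inv_Psi [of 0 N] by (simp add: Psi_0)

lemma Psi_inv_ge_1: "1 \<le> t \<Longrightarrow> Psi_inv N t = \<infinity>"
  by (simp add: Psi_inv_def)

lemma Psi_inv_nonneg:
  assumes "0 \<le> t"
  shows "0 \<le> Psi_inv (N::'n::finite itself) t"
proof (cases "t < 1")
  case True
  then obtain R where "0 \<le> R" "Psi N R = t"
    using Psi_surj assms by blast
  then show ?thesis
    using Psi_inv_Psi [of R N] by simp
qed (simp add: Psi_inv_ge_1)

lemma Psi_inv_mono:
  assumes "0 \<le> s" "s \<le> t"
  shows "Psi_inv (N::'n::finite itself) s \<le> Psi_inv N t"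
proof (cases "t < 1")
  case True
  obtain R R' where "0 \<le> R" "Psi N R = s" "0 \<le> R'" "Psi N R' = t"
    using Psi_surj [of s N] Psi_surj [of t N] assms True by (metis order.trans order.strict_trans1)
  then show ?thesis
    using assms Psi_inv_Psi [of R N] Psi_inv_Psi [of R' N] Psi_le_Psi_iff [of R' N R] by simp
qed (simp add: Psi_inv_ge_1)

lemma Psi_inv_scaleR:
  fixes A :: "(real^'n) set"
  assumes A: "A \<in> sets lebesgue" and c: "0 < c" "c \<le> 1"
  shows "ereal c * Psi_inv TYPE('n) (gauss A) \<le> Psi_inv TYPE('n) (gauss ((*\<^sub>R) c ` A))"
proof (cases "gauss ((*\<^sub>R) c ` A) < 1")
  case True
  then obtain R' where R': "0 \<le> R'" "Psi TYPE('n) R' = gauss ((*\<^sub>R) c ` A)"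
    using Psi_surj gauss_nonneg by metis
  have dilate: "c * r \<le> R'" if "0 \<le> r" "Psi TYPE('n) r \<le> gauss A" for r
  proof -
    have "Psi TYPE('n) (c * r) \<le> Psi TYPE('n) R'"
      using gauss_cball_scaleR_le [OF A c that(1)] that(2) R'(2) by (simp add: Psi_def)
    then show ?thesis
      using R'(1) Psi_le_Psi_iff by blast
  qed
  show ?thesis
  proof (cases "gauss A < 1")
    case True
    then obtain R where R: "0 \<le> R" "Psi TYPE('n) R = gauss A"
      using Psi_surj gauss_nonneg by metis
    then show ?thesis
      using dilate [of R] R' Psi_inv_Psi [of R "TYPE('n)"] Psi_inv_Psi [of R' "TYPE('n)"] by simp
  next
    case False
    obtain r where r: "0 \<le> r" "Psi TYPE('n) R' < Psi TYPE('n) r"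
      using ex_Psi_gt Psi_less_1 by blast
    have "c * (r / c) \<le> R'"
      using False r c Psi_le_1 [of "TYPE('n)" "r / c"] by (intro dilate) auto
    then show ?thesis
      using r R'(1) c Psi_le_Psi_iff [of R' "TYPE('n)" r] by simp
  qed
qed (simp add: Psi_inv_ge_1)

section \<open>Convex geometry\<close>

lemma zero_mem_symmetric_convex:
  assumes "symmetric_set K" "convex K" "K \<noteq> {}"
  shows "(0::real^'n) \<in> K"
proof -
  obtain x where x: "x \<in> K"
    using assms(3) by blast
  then have "- x \<in> K"
    using assms(1) unfolding symmetric_set_def by force
  then have "(1/2) *\<^sub>R x + (1/2) *\<^sub>R (- x) \<in> K"
    using convexD [OF assms(2) x, of "- x" "1/2" "1/2"] by simp
  then show ?thesis
    by simp
qed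

lemma convex_minkowski_comb:
  assumes "convex K" "convex L"
  shows "convex (minkowski_comb lam K L)"
proof -
  have "minkowski_comb lam K L = (\<Union>x\<in>(*\<^sub>R) lam ` K. \<Union>y\<in>(*\<^sub>R) (1 - lam) ` L. {x + y})"
    unfolding minkowski_comb_def by auto
  then show ?thesis
    using convex_sums [OF convex_scaling [OF assms(1)] convex_scaling [OF assms(2)]] by simp
qed

lemma closure_diff_convex_null:
  assumes "convex (S :: (real^'n) set)"
  shows "closure S - S \<in> null_sets lebesgue"
proof -
  have "closure S - S \<subseteq> frontier S"
    unfolding frontier_def using interior_subset by blast
  then show ?thesis
    using negligible_convex_frontier [OF assms] negligible_subset negligible_iff_null_sets by blast
qed

lemma sets_lebesgue_closed: "closed S \<Longrightarrow> S \<in> sets lebesgue"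
  by (metis borel_closed sets_completionI_sets sets_lborel)

lemma sets_lebesgue_convex:
  assumes "convex (S :: (real^'n) set)"
  shows "S \<in> sets lebesgue"
proof -
  have "S = closure S - (closure S - S)"
    using closure_subset by blast
  then show ?thesis
    using closure_diff_convex_null [OF assms] sets_lebesgue_closed [OF closed_closure]
    by (metis null_setsD2 sets.Diff)
qed

lemma gauss_closure_convex:
  assumes "convex (S :: (real^'n) set)"
  shows "gauss (closure S) = gauss S"
proof -
  have "closure S = S \<union> (closure S - S)"
    using closure_subset by blast
  then have "gauss (closure S) = measure gauss_measure (S \<union> (closure S - S))"
    by (simp add: gauss_def)
  also have "\<dots> = measure gauss_measure S"
    using null_sets_lebesgue_imp_gauss_measure [OF closure_diff_convex_null [OF assms]]
      sets_lebesgue_convex [OF assms]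
    by (intro measure_Un_null_set) auto
  finally show ?thesis
    by (simp add: gauss_def)
qed

lemma closed_geom_mean: "closed (geom_mean K L p)"
proof -
  have "closed {x::real^'n. ereal (x \<bullet> \<theta>) \<le> e}" for \<theta> :: "real^'n" and e
  proof (cases e)
    case (real r)
    then have "{x::real^'n. ereal (x \<bullet> \<theta>) \<le> e} = {x. \<theta> \<bullet> x \<le> r}"
      by (auto simp: inner_commute)
    then show ?thesis
      using closed_halfspace_le [of \<theta> r] by simp
  qed simp_all
  then show ?thesis
    unfolding geom_mean_def by (intro closed_INT ballI)
qed

definition amgm_factor :: "real \<Rightarrow> real \<Rightarrow> real" where
  "amgm_factor lam p = (lam / p) powr p * ((1 - lam) / (1 - p)) powr (1 - p)"

lemma amgm_factor_mult_le:
  assumes lam: "0 < lam" "lam < 1" and p: "0 < p" "p < 1" and "0 \<le> u" "0 \<le> v"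
  shows "amgm_factor lam p * (u powr p * v powr (1 - p)) \<le> lam * u + (1 - lam) * v"
proof (cases "u = 0 \<or> v = 0")
  case False
  then have uv: "0 < u" "0 < v"
    using assms by auto
  have "(lam / p * u) powr p = (lam / p) powr p * u powr p"
    using lam p uv powr_mult [of "lam / p" u p] by simp
  moreover have "((1 - lam) / (1 - p) * v) powr (1 - p) = ((1 - lam) / (1 - p)) powr (1 - p) * v powr (1 - p)"
    using lam p uv powr_mult [of "(1 - lam) / (1 - p)" v "1 - p"] by simp
  ultimately have "amgm_factor lam p * (u powr p * v powr (1 - p)) =
      (lam / p * u) powr p * ((1 - lam) / (1 - p) * v) powr (1 - p)"
    unfolding amgm_factor_def by (simp only: mult_ac)
  also have "\<dots> \<le> p * (lam / p * u) + (1 - p) * ((1 - lam) / (1 - p) * v)"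
    using lam p uv by (intro Youngs_inequality_0) auto
  also have "\<dots> = lam * u + (1 - lam) * v"
    using p by (simp add: field_simps)
  finally show ?thesis .
qed (use assms in auto)

lemma amgm_factor_pos: "0 < lam \<Longrightarrow> lam < 1 \<Longrightarrow> 0 < p \<Longrightarrow> p < 1 \<Longrightarrow> 0 < amgm_factor lam p"
  by (simp add: amgm_factor_def)

lemma amgm_factor_le_1: "0 < lam \<Longrightarrow> lam < 1 \<Longrightarrow> 0 < p \<Longrightarrow> p < 1 \<Longrightarrow> amgm_factor lam p \<le> 1"
  using amgm_factor_mult_le [of lam p 1 1] by simp

lemma separating_unit_hyperplane:
  fixes S :: "'a::euclidean_space set"
  assumes "convex S" "closed S" "S \<noteq> {}" "y \<notin> S"
  obtains \<theta> \<beta> where "norm \<theta> = 1" "\<And>z. z \<in> S \<Longrightarrow> z \<bullet> \<theta> < \<beta>" "\<beta> < y \<bullet> \<theta>"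
proof -
  obtain a b where ab: "a \<bullet> y < b" "\<And>z. z \<in> S \<Longrightarrow> b < a \<bullet> z"
    using separating_hyperplane_closed_point [OF assms(1,2,4)] by blast
  have "a \<noteq> 0"
    using ab assms(3) by force
  then have a: "0 < norm a"
    by simp
  show ?thesis
  proof (rule that [of "- (1 / norm a) *\<^sub>R a" "- b / norm a"])
    show "norm (- (1 / norm a) *\<^sub>R a) = 1"
      using a by simp
    show "z \<bullet> (- (1 / norm a) *\<^sub>R a) < - b / norm a" if "z \<in> S" for z
      using ab(2) [OF that] a by (simp add: inner_commute divide_strict_right_mono)
    show "- b / norm a < y \<bullet> (- (1 / norm a) *\<^sub>R a)"
      using ab(1) a by (simp add: inner_commute divide_strict_right_mono)
  qed
qed

lemma supp_fun_bounded:
  assumes "0 \<in> K" "\<And>k. k \<in> K \<Longrightarrow> k \<bullet> \<theta> \<le> B"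
  obtains h where "supp_fun K \<theta> = ereal h" "0 \<le> h" "h \<le> B"
proof -
  have "supp_fun K \<theta> \<le> ereal B"
    unfolding supp_fun_def using assms(2) by (intro SUP_least) auto
  moreover have "ereal 0 \<le> supp_fun K \<theta>"
    unfolding supp_fun_def using SUP_upper [OF assms(1), of "\<lambda>y. ereal (y \<bullet> \<theta>)"] by simp
  ultimately show ?thesis
    using that by (cases "supp_fun K \<theta>") auto
qed

lemma supp_fun_minkowski_comb_le:
  assumes "0 \<in> K" "0 \<in> L" and lam: "0 < lam" "lam < 1"
    and bound: "\<And>m. m \<in> minkowski_comb lam K L \<Longrightarrow> m \<bullet> \<theta> \<le> \<beta>"
  obtains hK hL where "supp_fun K \<theta> = ereal hK" "supp_fun L \<theta> = ereal hL" "0 \<le> hK" "0 \<le> hL"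
    "lam * hK + (1 - lam) * hL \<le> \<beta>"
proof -
  have KL: "k \<bullet> \<theta> \<le> (\<beta> - (1 - lam) * (l \<bullet> \<theta>)) / lam" if "k \<in> K" "l \<in> L" for k l
  proof -
    have "lam *\<^sub>R k + (1 - lam) *\<^sub>R l \<in> minkowski_comb lam K L"
      using that unfolding minkowski_comb_def by blast
    then show ?thesis
      using bound lam by (fastforce simp: inner_add_left pos_le_divide_eq algebra_simps)
  qed
  obtain hK where hK: "supp_fun K \<theta> = ereal hK" "0 \<le> hK"
    using supp_fun_bounded [OF assms(1)] KL [OF _ assms(2)] by blast
  have "l \<bullet> \<theta> \<le> (\<beta> - lam * hK) / (1 - lam)" if "l \<in> L" for l
  proof -
    have "supp_fun K \<theta> \<le> ereal ((\<beta> - (1 - lam) * (l \<bullet> \<theta>)) / lam)"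
      unfolding supp_fun_def using KL [OF _ that] by (intro SUP_least) auto
    then show ?thesis
      using hK(1) lam by (simp add: pos_le_divide_eq pos_divide_le_eq algebra_simps)
  qed
  then obtain hL where hL: "supp_fun L \<theta> = ereal hL" "0 \<le> hL" "hL \<le> (\<beta> - lam * hK) / (1 - lam)"
    using supp_fun_bounded [OF assms(2)] by blast
  show ?thesis
    using that hK hL lam by (simp add: pos_le_divide_eq algebra_simps)
qed

lemma scaleR_geom_mean_subset_closure:
  assumes K: "symmetric_set K" "convex K" "K \<noteq> {}" and L: "symmetric_set L" "convex L" "L \<noteq> {}"
    and lam: "0 < lam" "lam < 1" and p: "0 < p" "p < 1"
  shows "(*\<^sub>R) (amgm_factor lam p) ` geom_mean K L p \<subseteq> closure (minkowski_comb lam K (L :: (real^'n) set))"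
proof
  let ?c = "amgm_factor lam p" and ?M = "minkowski_comb lam K L"
  fix y assume "y \<in> (*\<^sub>R) ?c ` geom_mean K L p"
  then obtain x where x: "x \<in> geom_mean K L p" and y: "y = ?c *\<^sub>R x"
    by auto
  have 0: "0 \<in> K" "0 \<in> L"
    using K L by (auto intro: zero_mem_symmetric_convex)
  then have "0 \<in> ?M"
    unfolding minkowski_comb_def by force
  show "y \<in> closure ?M"
  proof (rule ccontr)
    assume "y \<notin> closure ?M"
    then obtain \<theta> \<beta> where \<theta>: "norm \<theta> = 1" "\<And>z. z \<in> closure ?M \<Longrightarrow> z \<bullet> \<theta> < \<beta>" "\<beta> < y \<bullet> \<theta>"
      using separating_unit_hyperplane [of "closure ?M" y] \<open>0 \<in> ?M\<close> closure_subset
        convex_closure [OF convex_minkowski_comb [OF K(2) L(2)]]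
      by blast
    obtain hK hL where h: "supp_fun K \<theta> = ereal hK" "supp_fun L \<theta> = ereal hL" "0 \<le> hK" "0 \<le> hL"
      "lam * hK + (1 - lam) * hL \<le> \<beta>"
      using supp_fun_minkowski_comb_le [OF 0 lam, of \<theta> \<beta>] \<theta>(2) closure_subset
      by (metis less_imp_le subsetD)
    have "ereal (x \<bullet> \<theta>) \<le> epow (supp_fun K \<theta>) p * epow (supp_fun L \<theta>) (1 - p)"
      using x \<theta>(1) unfolding geom_mean_def by auto
    then have "x \<bullet> \<theta> \<le> hK powr p * hL powr (1 - p)"
      using h(1,2) by (simp add: epow_def)
    then have "y \<bullet> \<theta> \<le> ?c * (hK powr p * hL powr (1 - p))"
      using amgm_factor_pos [OF lam p] by (simp add: y mult_left_mono)
    also have "\<dots> \<le> lam * hK + (1 - lam) * hL"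
      using lam p h(3,4) by (rule amgm_factor_mult_le)
    finally show False
      using \<theta>(3) h(5) by simp
  qed
qed

lemma Psi_inv_minkowski_comb_ge:
  fixes K L :: "(real^'n) set"
  assumes K: "symmetric_set K" "convex K" and L: "symmetric_set L" "convex L"
    and lam: "0 < lam" "lam < 1" and p: "0 < p" "p < 1"
    and geom_mean_ge: "gauss K powr p * gauss L powr (1 - p) \<le> gauss (geom_mean K L p)"
  shows "ereal (amgm_factor lam p) * Psi_inv TYPE('n) (gauss K powr p * gauss L powr (1 - p))
    \<le> Psi_inv TYPE('n) (gauss (minkowski_comb lam K L))"
proof (cases "K = {} \<or> L = {}")
  case True
  then have zero: "gauss K powr p * gauss L powr (1 - p) = 0"
    by (auto simp: gauss_def)
  show ?thesis
    unfolding zero Psi_inv_0 using Psi_inv_nonneg [OF gauss_nonneg] by simp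
next
  case False
  let ?c = "amgm_factor lam p" and ?G = "geom_mean K L p" and ?M = "minkowski_comb lam K L"
  have c: "0 < ?c" "?c \<le> 1"
    using lam p by (auto intro: amgm_factor_pos amgm_factor_le_1)
  have "ereal ?c * Psi_inv TYPE('n) (gauss K powr p * gauss L powr (1 - p))
      \<le> ereal ?c * Psi_inv TYPE('n) (gauss ?G)"
    using geom_mean_ge c by (intro ereal_mult_left_mono Psi_inv_mono) auto
  also have "\<dots> \<le> Psi_inv TYPE('n) (gauss ((*\<^sub>R) ?c ` ?G))"
    using c by (intro Psi_inv_scaleR sets_lebesgue_closed closed_geom_mean) auto
  also have "\<dots> \<le> Psi_inv TYPE('n) (gauss (closure ?M))"
    using False K L lam p
    by (intro Psi_inv_mono gauss_mono gauss_nonneg scaleR_geom_mean_subset_closure) auto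
  also have "\<dots> = Psi_inv TYPE('n) (gauss ?M)"
    using K L by (simp add: gauss_closure_convex convex_minkowski_comb)
  finally show ?thesis .
qed

theorem proposition4p2:
  assumes hyp: "\<forall>(K::(real^'n) set) L lam. symmetric_set K \<and> convex K \<and> symmetric_set L \<and> convex L
      \<and> 0 < lam \<and> lam < 1 \<longrightarrow>
      gauss (geom_mean K L lam) \<ge> gauss K powr lam * gauss L powr (1 - lam)"
    and K: "symmetric_set (K::(real^'n) set)" "convex K"
    and L: "symmetric_set L" "convex L"
    and lam: "0 < lam" "lam < 1"
  shows "Psi_inv TYPE('n) (gauss (minkowski_comb lam K L)) \<ge>
    (SUP p\<in>{0<..<1}. ereal ((lam / p) powr p * ((1 - lam) / (1 - p)) powr (1 - p))
        * Psi_inv TYPE('n) (gauss K powr p * gauss L powr (1 - p)))"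
proof (rule SUP_least)
  fix p :: real
  assume "p \<in> {0<..<1}"
  then show "ereal ((lam / p) powr p * ((1 - lam) / (1 - p)) powr (1 - p))
      * Psi_inv TYPE('n) (gauss K powr p * gauss L powr (1 - p))
    \<le> Psi_inv TYPE('n) (gauss (minkowski_comb lam K L))"
    using Psi_inv_minkowski_comb_ge [OF K L lam, of p] hyp K L
    unfolding amgm_factor_def by auto
qed

end
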